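(* Let $Q\subset\mathbb{R}^2$ be a convex polygon, let $P=(p_1,\dots,p_n)\in Q^n$ be a nondegenerate configuration, and assume $0\in\operatorname{int}(\partial\mathcal{H}_{\mathrm{DC}}(P))$ (interior in $(\mathbb{R}^2)^n$). Then $P$ is a strict local minimum of $\mathcal{H}_{\mathrm{DC}}$, all generators are active (that is, $G_i(P)=\mathcal{H}_{\mathrm{DC}}(P)$ for all $i\in\{1,\dots,n\}$), and $P$ is a circumcenter Voronoi configuration (that is, $p_i=\operatorname{CC}(V_i(P))$ for all $i\in\{1,\dots,n\}$).
   Context: $\|\cdot\|$ is the Euclidean norm. For $P=(p_1,\dots,p_n)\in Q^n$, the Voronoi cells are $V_i(P)=\{q\in Q : \|q-p_i\|\le\|q-p_j\|\ \forall j\ne i\}$, and $\mathcal{V}(P)=(V_1(P),\dots,V_n(P))$ is the Voronoi partition. The multi-circumcenter function is $\mathcal{H}_{\mathrm{DC}}(P)=\max_{q\in Q}\min_{i\in\{1,\dots,n\}}\|q-p_i\|$, and $G_i(P)=\max_{q\in V_i(P)}\|q-p_i\|$, so that $\mathcal{H}_{\mathrm{DC}}(P)=\max_i G_i(P)$. The generator $p_i$ is active at $P$ if $G_i(P)=\mathcal{H}_{\mathrm{DC}}(P)$. A vertex $v$ of the Voronoi partition is of type (a) if it is the center of the circle through three generators, of type (b) if it is the intersection of an edge of $Q$ with the bisector of two generators, and of type (c) if it is a vertex of $Q$ (determined by two edges of $Q$ and the generator of a cell containing it). A vertex is nondegenerate if it is determined by exactly three elements (three generators, or one edge of $Q$ and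 two generators, or two edges of $Q$ and one generator); otherwise it is degenerate. The configuration $P$ is nondegenerate if all vertices of its Voronoi partition are nondegenerate. The circumcenter $\operatorname{CC}(W)$ of a polytope $W$ is the center of the minimum-radius sphere (disk) containing $W$. For a locally Lipschitz function $f$, the (Clarke) generalized gradient is $\partial f(x)=\operatorname{co}\{\lim_{i\to\infty}df(x_i) : x_i\to x,\ x_i\notin S\cup\Omega_f\}$, where $\Omega_f$ is the set of points where $f$ is not differentiable, $S$ is any set of measure zero, and $\operatorname{co}$ is the convex hull. *)

theory Defs
  imports "HOL-Analysis.Analysis"
begin

text \<open>
  A configuration of generators is a vector of type \<open>(real^2)^'n\<close>, whose norm is the Euclidean
  norm of \<open>(\<real>\<^sup>2)\<^sup>n\<close>. All functions of a configuration are defined by their formulas on the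
  whole space, not only on \<open>Q\<^sup>n\<close>.
\<close>

definition convex_polygon :: "(real^2) set \<Rightarrow> bool" where
  "convex_polygon Q \<longleftrightarrow> polytope Q \<and> interior Q \<noteq> {}"

definition voronoi_cell :: "(real^2) set \<Rightarrow> (real^2)^'n \<Rightarrow> 'n::finite \<Rightarrow> (real^2) set" where
  "voronoi_cell Q P i = {q \<in> Q. \<forall>j. j \<noteq> i \<longrightarrow> norm (q - P $ i) \<le> norm (q - P $ j)}"

text \<open>
  Both suprema are maxima when \<open>Q\<close> is compact and nonempty and, for the second one, the cell is
  nonempty (e.g. when \<open>P $ i \<in> Q\<close>).
\<close>

definition H_DC :: "(real^2) set \<Rightarrow> (real^2)^'n::finite \<Rightarrow> real" where
  "H_DC Q P = (SUP q\<in>Q. Min (range (\<lambda>i. norm (q - P $ i))))"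

definition G_cell :: "(real^2) set \<Rightarrow> (real^2)^'n::finite \<Rightarrow> 'n \<Rightarrow> real" where
  "G_cell Q P i = (SUP q\<in>voronoi_cell Q P i. norm (q - P $ i))"

definition active :: "(real^2) set \<Rightarrow> (real^2)^'n::finite \<Rightarrow> 'n \<Rightarrow> bool" where
  "active Q P i \<longleftrightarrow> G_cell Q P i = H_DC Q P"

definition voronoi_vertex :: "(real^2) set \<Rightarrow> (real^2)^'n::finite \<Rightarrow> real^2 \<Rightarrow> bool" where
  "voronoi_vertex Q P v \<longleftrightarrow> (\<exists>i. v extreme_point_of voronoi_cell Q P i)"

text \<open>
  The elements determining a vertex \<open>v\<close> are the edges of \<open>Q\<close> through \<open>v\<close> and the generators whose
  cells contain \<open>v\<close>, i.e. the generators nearest to \<open>v\<close>, which all lie on one circle around \<open>v\<close>.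
  Generators are counted by index, so coinciding generators count separately.
\<close>

definition determining_edges :: "(real^2) set \<Rightarrow> real^2 \<Rightarrow> (real^2) set set" where
  "determining_edges Q v = {e. e edge_of Q \<and> v \<in> e}"

definition determining_generators ::
    "(real^2) set \<Rightarrow> (real^2)^'n::finite \<Rightarrow> real^2 \<Rightarrow> 'n set" where
  "determining_generators Q P v = {i. v \<in> voronoi_cell Q P i}"

definition nondegenerate_vertex :: "(real^2) set \<Rightarrow> (real^2)^'n::finite \<Rightarrow> real^2 \<Rightarrow> bool" where
  "nondegenerate_vertex Q P v \<longleftrightarrow>
     (let e = card (determining_edges Q v); g = card (determining_generators Q P v)
      in e = 0 \<and> g = 3 \<or> e = 1 \<and> g = 2 \<or> e = 2 \<and> g = 1)"

definition nondegenerate_configuration :: "(real^2) set \<Rightarrow> (real^2)^'n::finite \<Rightarrow> bool" where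
  "nondegenerate_configuration Q P \<longleftrightarrow>
     (\<forall>v. voronoi_vertex Q P v \<longrightarrow> nondegenerate_vertex Q P v)"

text \<open>The minimum-radius disk containing a nonempty bounded set exists and is unique.\<close>

definition circumcenter :: "(real^2) set \<Rightarrow> real^2" where
  "circumcenter W =
     (THE c. \<exists>r. W \<subseteq> cball c r \<and> (\<forall>c' r'. W \<subseteq> cball c' r' \<longrightarrow> r \<le> r'))"

text \<open>
  Generalized gradient of a locally Lipschitz function \<open>f\<close>, where \<open>S\<close> is the set of measure zero
  avoided, besides the points of nondifferentiability, by the approximating sequences.
\<close>

definition clarke_gradient ::
    "'a::euclidean_space set \<Rightarrow> ('a \<Rightarrow> real) \<Rightarrow> 'a \<Rightarrow> 'a set" where
  "clarke_gradient S f x = convex hull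
     {l. \<exists>X g. X \<longlonglongrightarrow> x \<and> (\<forall>k. X k \<notin> S \<and> GDERIV f (X k) :> g k) \<and> g \<longlonglongrightarrow> l}"

definition strict_local_min :: "('a::metric_space \<Rightarrow> real) \<Rightarrow> 'a \<Rightarrow> bool" where
  "strict_local_min f x \<longleftrightarrow> (\<exists>\<epsilon>>0. \<forall>y. y \<noteq> x \<and> dist y x < \<epsilon> \<longrightarrow> f x < f y)"

end

theory Submission
  imports Defs
begin

text \<open>
  Let \<open>v\<close> be a maximizer over \<open>Q\<close> of the distance to the nearest generator. No direction \<open>u \<noteq> 0\<close>
  can satisfy \<open>a \<bullet> u \<le> 0\<close> for all determining vectors \<open>a\<close> (the vectors \<open>p\<^sub>i - v\<close> of the nearest
  generators and the outer normals of the edges through \<open>v\<close>): moving \<open>v\<close> along \<open>u\<close> would stay in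
  \<open>Q\<close> and increase the distance, to second order if not to first. Hence at least three vectors are
  needed, and nondegeneracy says that there are exactly three. They carry a positive linear relation,
  unique up to scale, whose weights on the generators define a vector \<open>g\<^sub>v\<close> with
  \<open>H(P') \<ge> H(P) + g\<^sub>v \<bullet> (P' - P)\<close> for \<open>P'\<close> near \<open>P\<close>: moving \<open>v\<close> along its edges, one keeps the
  linearized distances to the generators equal, and distances dominate their linearizations.

  Near \<open>P\<close> every maximizer is determined by the same elements as some maximizer at \<open>P\<close>, so where
  \<open>H\<close> is differentiable its gradient is the corresponding vector, by the lower bound. In the limit
  the generalized gradient lies in the convex hull of the \<open>g\<^sub>v\<close>. If \<open>0\<close> is interior to it, then
  each direction \<open>d \<noteq> 0\<close> has \<open>g\<^sub>v \<bullet> d > 0\<close> for some \<open>v\<close>, and so \<open>H\<close> grows along \<open>d\<close>. For \<open>d\<close>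
  supported on the generator \<open>p\<^sub>i\<close> this provides a farthest point of \<open>V\<^sub>i\<close> on the side opposite to
  \<open>d\<close>, so that \<open>p\<^sub>i\<close> is active and no other disk of radius at most \<open>H(P)\<close> contains \<open>V\<^sub>i\<close>.
\<close>

subsection \<open>Three vectors in the plane\<close>

definition cross2 :: "real^2 \<Rightarrow> real^2 \<Rightarrow> real" where
  "cross2 x y = x $ 1 * y $ 2 - x $ 2 * y $ 1"

text \<open>
  For three vectors these are, up to the common factor \<open>2\<close>, the coefficients of the relation
  \<open>cross2 y z *\<^sub>R x + cross2 z x *\<^sub>R y + cross2 x y *\<^sub>R z = 0\<close>, in a form that does not depend on the
  order of the vectors.
\<close>

definition weight :: "('k \<Rightarrow> real^2) \<Rightarrow> 'k set \<Rightarrow> 'k \<Rightarrow> real" where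
  "weight a K k = (\<Sum>i\<in>K - {k}. \<Sum>j\<in>K - {k}. \<bar>cross2 (a i) (a j)\<bar>)"

text \<open>For finite \<open>K\<close> this means that the nonnegative combinations of the vectors
  fill the plane; the dual form is the one that maximality of a point yields directly.\<close>

definition positively_spanning :: "('k \<Rightarrow> real^2) \<Rightarrow> 'k set \<Rightarrow> bool" where
  "positively_spanning a K \<longleftrightarrow> (\<forall>u. u \<noteq> 0 \<longrightarrow> (\<exists>k\<in>K. a k \<bullet> u > 0))"

lemma inner_vec2: "x \<bullet> y = x $ 1 * y $ 1 + x $ 2 * y $ 2" for x y :: "real^2"
  by (simp add: inner_vec_def sum_2)

lemma cross2_sym: "cross2 y x = - cross2 x y" and cross2_self: "cross2 x x = 0"
  by (simp_all add: cross2_def)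

lemma cross2_rot: "y \<bullet> vector [- x $ 2, x $ 1] = cross2 x y"
  by (simp add: inner_vec2 cross2_def)

lemma rot_eq_0_iff: "vector [- x $ 2, x $ 1] = (0::real^2) \<longleftrightarrow> x = 0" for x :: "real^2"
  by (auto simp: vec_eq_iff forall_2)

text \<open>A quarter turn of \<open>x\<close> is orthogonal to \<open>x\<close>, and its sign can
  be chosen to suit \<open>y\<close>; if \<open>x\<close> vanishes, a quarter turn of
  \<open>y\<close> serves.\<close>

lemma not_spanning_pair:
  fixes x y :: "real^2"
  obtains u where "u \<noteq> 0" "x \<bullet> u \<le> 0" "y \<bullet> u \<le> 0"
proof -
  define r where "r z = (vector [- z $ 2, z $ 1] :: real^2)" for z :: "real^2"
  have r: "y \<bullet> r x = cross2 x y" "r x = 0 \<longleftrightarrow> x = 0" for x y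
    unfolding r_def by (rule cross2_rot rot_eq_0_iff)+
  show thesis
  proof (cases "x = 0")
    case False
    show thesis
    proof (cases "cross2 x y \<le> 0")
      case True
      with False show thesis by (intro that[of "r x"]) (auto simp: r cross2_self)
    next
      case neg: False
      with False show thesis by (intro that[of "- r x"]) (auto simp: r cross2_self)
    qed
  next
    case True
    show thesis
    proof (cases "y = 0")
      case False
      with True show thesis by (intro that[of "r y"]) (auto simp: r cross2_self cross2_def)
    next
      case y: True
      have "axis 1 1 \<noteq> (0::real^2)" by (simp add: axis_eq_0_iff)
      with True y show thesis by (intro that[of "axis 1 1"]) auto
    qed
  qed
qed

text \<open>Both quarter turns of \<open>x\<close> are orthogonal to \<open>x\<close>, so one of
  \<open>y\<close> and \<open>z\<close> must serve each of them: the two lie strictly on opposite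
  sides of the line spanned by \<open>x\<close>.\<close>

lemma positively_spanning_triple_signs:
  fixes x y z :: "real^2"
  assumes "\<And>u. u \<noteq> 0 \<Longrightarrow> x \<bullet> u > 0 \<or> y \<bullet> u > 0 \<or> z \<bullet> u > 0"
  shows "cross2 x y > 0 \<and> cross2 z x > 0 \<or> cross2 x y < 0 \<and> cross2 z x < 0"
proof -
  define r where "r = (vector [- x $ 2, x $ 1] :: real^2)"
  have "x \<noteq> 0"
  proof
    assume "x = 0"
    obtain u where "u \<noteq> 0" "y \<bullet> u \<le> 0" "z \<bullet> u \<le> 0" by (rule not_spanning_pair)
    with assms[of u] \<open>x = 0\<close> show False by auto
  qed
  then have "r \<noteq> 0" unfolding r_def by (simp add: rot_eq_0_iff)
  with assms[of r] assms[of "- r"] show ?thesis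
    by (simp add: cross2_rot r_def cross2_self cross2_sym[of z x]) (smt (verit))
qed

lemma cross2_relation:
  "cross2 y z *\<^sub>R x + cross2 z x *\<^sub>R y + cross2 x y *\<^sub>R z = 0" for x y z :: "real^2"
  by (simp add: vec_eq_iff forall_2 cross2_def algebra_simps)

lemma solve_cross2:
  fixes x y :: "real^2"
  assumes "cross2 x y \<noteq> 0"
  obtains u where "x \<bullet> u = s" "y \<bullet> u = t"
proof
  \<comment> \<open>Cramer's rule.\<close>
  let ?u = "vector [(s * y $ 2 - t * x $ 2) / cross2 x y, (t * x $ 1 - s * y $ 1) / cross2 x y] :: real^2"
  show "x \<bullet> ?u = s" "y \<bullet> ?u = t"
    using assms by (simp_all add: inner_vec2 field_simps) (simp_all add: cross2_def algebra_simps)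
qed

lemma positively_spanning_card_3:
  fixes a :: "'k \<Rightarrow> real^2"
  assumes "positively_spanning a K" "finite K" "card K \<le> 3"
  obtains x y z where "K = {x, y, z}" "x \<noteq> y" "y \<noteq> z" "x \<noteq> z"
proof -
  have "card K \<noteq> 0"
  proof
    assume "card K = 0"
    with assms have "K = {}" by simp
    moreover obtain u :: "real^2" where "u \<noteq> 0" using not_spanning_pair[of 0 0] by metis
    ultimately show False using assms(1) by (auto simp: positively_spanning_def)
  qed
  moreover have False if K: "K = {x, y}" for x y
  proof -
    obtain u where "u \<noteq> 0" "a x \<bullet> u \<le> 0" "a y \<bullet> u \<le> 0" by (rule not_spanning_pair)
    with assms(1) K show False by (auto simp: positively_spanning_def)
  qed
  then have "card K \<noteq> 1" "card K \<noteq> 2" 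
    by (metis card_1_singletonE insert_absorb2, metis card_2_iff)
  ultimately have "card K = 3" using assms by linarith
  then show thesis using that by (auto simp: card_3_iff)
qed

text \<open>The three cross products have one common sign, so the weights are the coefficients of
  the linear relation up to a common factor. In the last claim two equations are solved by Cramer's
  rule, and the relation forces the third.\<close>

lemma positively_spanning_weight:
  fixes a :: "'k \<Rightarrow> real^2"
  assumes span: "positively_spanning a K" and "finite K" "card K \<le> 3"
  shows "card K = 3"
    and "k \<in> K \<Longrightarrow> weight a K k > 0"
    and "(\<Sum>k\<in>K. weight a K k * \<beta> k) = 0 \<Longrightarrow> \<exists>u. \<forall>k\<in>K. a k \<bullet> u = \<beta> k"
proof -
  obtain x y z where K: "K = {x, y, z}" and ne: "x \<noteq> y" "y \<noteq> z" "x \<noteq> z"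
    using positively_spanning_card_3[OF assms] .
  show "card K = 3" using K ne by auto
  define p q r where "p = cross2 (a y) (a z)" and "q = cross2 (a z) (a x)" and "r = cross2 (a x) (a y)"
  have alt: "a x \<bullet> u > 0 \<or> a y \<bullet> u > 0 \<or> a z \<bullet> u > 0" if "u \<noteq> 0" for u
    using span that by (auto simp: positively_spanning_def K)
  have "r > 0 \<and> q > 0 \<or> r < 0 \<and> q < 0"
    unfolding r_def q_def by (rule positively_spanning_triple_signs) (use alt in blast)
  moreover have "p > 0 \<and> r > 0 \<or> p < 0 \<and> r < 0"
    unfolding r_def p_def by (rule positively_spanning_triple_signs) (use alt in blast)
  ultimately have sgn: "p > 0 \<and> q > 0 \<and> r > 0 \<or> p < 0 \<and> q < 0 \<and> r < 0" by auto
  have diff: "K - {x} = {y, z}" "K - {y} = {z, x}" "K - {z} = {x, y}" using K ne by auto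
  have w: "weight a K x = 2 * \<bar>p\<bar>" "weight a K y = 2 * \<bar>q\<bar>" "weight a K z = 2 * \<bar>r\<bar>"
    using ne unfolding weight_def diff
    by (simp_all add: p_def q_def r_def cross2_self cross2_sym[of "a y" "a z"] 
        cross2_sym[of "a z" "a x"] cross2_sym[of "a x" "a y"])
  show "weight a K k > 0" if "k \<in> K" using that sgn w K by auto
  assume "(\<Sum>k\<in>K. weight a K k * \<beta> k) = 0"
  then have "2 * (\<bar>p\<bar> * \<beta> x + \<bar>q\<bar> * \<beta> y + \<bar>r\<bar> * \<beta> z) = 0"
    using ne w unfolding K by (simp add: algebra_simps)
  then have rel: "p * \<beta> x + q * \<beta> y + r * \<beta> z = 0" using sgn by auto
  obtain u where u: "a x \<bullet> u = \<beta> x" "a y \<bullet> u = \<beta> y"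
    using solve_cross2[of "a x" "a y" "\<beta> x" "\<beta> y"] sgn unfolding r_def by (metis less_irrefl)
  have "p * (a x \<bullet> u) + q * (a y \<bullet> u) + r * (a z \<bullet> u) = 0"
    using arg_cong[OF cross2_relation[of "a y" "a z" "a x"], of "\<lambda>t. t \<bullet> u"]
    by (simp add: inner_add_left p_def q_def r_def)
  with rel u have "r * (a z \<bullet> u) = r * \<beta> z" by (smt (verit))
  with sgn have "a z \<bullet> u = \<beta> z" by auto
  with u show "\<exists>u. \<forall>k\<in>K. a k \<bullet> u = \<beta> k" by (auto simp: K)
qed

text \<open>The sum of the positive parts of the inner products attains a positive minimum on the
  unit circle. Since the largest part is at least the average, this minimum divided by the number of
  vectors serves as \<open>c\<close>.\<close>

lemma positively_spanning_coercive:
  fixes a :: "'k \<Rightarrow> real^2"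
  assumes span: "positively_spanning a K" and "finite K"
  obtains c where "c > 0" "\<And>u. u \<noteq> 0 \<Longrightarrow> \<exists>k\<in>K. c * norm u \<le> a k \<bullet> u"
proof -
  have "K \<noteq> {}" 
  proof -
    obtain u :: "real^2" where "u \<noteq> 0" using not_spanning_pair[of 0 0] by metis
    with span show ?thesis by (auto simp: positively_spanning_def)
  qed
  let ?f = "\<lambda>u. \<Sum>k\<in>K. max 0 (a k \<bullet> u)"
  have "continuous_on (sphere 0 1) ?f" by (intro continuous_intros)
  moreover have "sphere (0::real^2) 1 \<noteq> {}" by simp
  ultimately have "\<exists>u0\<in>sphere 0 1. \<forall>u\<in>sphere 0 1. ?f u0 \<le> ?f u"
    by (intro continuous_attains_inf compact_sphere)
  then obtain u0 where u0: "u0 \<in> sphere 0 1" "\<forall>u\<in>sphere 0 1. ?f u0 \<le> ?f u" by blast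
  then have "u0 \<noteq> 0" by auto
  then obtain k0 where "k0 \<in> K" "a k0 \<bullet> u0 > 0" using span by (auto simp: positively_spanning_def)
  then have pos: "?f u0 > 0" using \<open>finite K\<close> by (intro sum_pos2[of K k0]) auto
  let ?c = "?f u0 / card K"
  show thesis
  proof
    show "?c > 0" using pos \<open>finite K\<close> \<open>K \<noteq> {}\<close> by (simp add: card_gt_0_iff)
    fix u :: "real^2" assume "u \<noteq> 0"
    show "\<exists>k\<in>K. ?c * norm u \<le> a k \<bullet> u"
    proof (rule ccontr)
      assume "\<not> ?thesis"
      then have "a k \<bullet> (u /\<^sub>R norm u) < ?c" if "k \<in> K" for k
        using that \<open>u \<noteq> 0\<close> by (auto simp: field_simps not_le)
      then have "max 0 (a k \<bullet> (u /\<^sub>R norm u)) < ?c" if "k \<in> K" for k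
        using that \<open>?c > 0\<close> by simp
      then have "?f (u /\<^sub>R norm u) < (\<Sum>k\<in>K. ?c)"
        using \<open>finite K\<close> \<open>K \<noteq> {}\<close> by (intro sum_strict_mono) auto
      also have "\<dots> = ?f u0" using \<open>finite K\<close> \<open>K \<noteq> {}\<close> by simp
      finally have "?f (u /\<^sub>R norm u) < ?f u0" .
      moreover have "u /\<^sub>R norm u \<in> sphere 0 1" using \<open>u \<noteq> 0\<close> by simp
      ultimately show False using u0(2) by (meson linorder_not_less)
    qed
  qed
qed

subsection \<open>Maximizers of the distance to the nearest generator\<close>

definition near :: "(real^2)^'n::finite \<Rightarrow> real^2 \<Rightarrow> real" where
  "near P q = Min (range (\<lambda>i. norm (q - P $ i)))"

definition nearest :: "(real^2)^'n::finite \<Rightarrow> real^2 \<Rightarrow> 'n set" where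
  "nearest P q = {i. norm (q - P $ i) = near P q}"

definition peak :: "(real^2) set \<Rightarrow> (real^2)^'n::finite \<Rightarrow> real^2 \<Rightarrow> bool" where
  "peak Q P v \<longleftrightarrow> v \<in> Q \<and> (\<forall>q\<in>Q. near P q \<le> near P v)"

lemma near_le: "near P q \<le> norm (q - P $ i)"
  by (auto simp: near_def)

lemma nearest_nonempty: "nearest P q \<noteq> {}"
proof -
  have "near P q \<in> range (\<lambda>i. norm (q - P $ i))" unfolding near_def by (intro Min_in) auto
  then show ?thesis by (auto simp: nearest_def)
qed

lemma near_ge_iff: "c \<le> near P q \<longleftrightarrow> (\<forall>i. c \<le> norm (q - P $ i))"
  by (auto simp: near_def)

lemma near_gt_iff: "c < near P q \<longleftrightarrow> (\<forall>i. c < norm (q - P $ i))"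
  by (auto simp: near_def)

lemma near_nonneg: "near P q \<ge> 0"
  by (simp add: near_ge_iff)

lemma near_eq_0_imp: "near P q = 0 \<Longrightarrow> q \<in> range (($) P)"
  using nearest_nonempty[of P q] by (auto simp: nearest_def)

lemma near_lipschitz: "\<bar>near P q - near P' q'\<bar> \<le> norm (q - q') + norm (P - P')"
proof -
  have "near P q \<le> near P' q' + (norm (q - q') + norm (P - P'))" for P P' and q q'
  proof -
    obtain i where i: "norm (q' - P' $ i) = near P' q'"
      using nearest_nonempty[of P' q'] by (auto simp: nearest_def)
    have "near P q \<le> norm (q - P $ i)" by (rule near_le)
    also have "q - P $ i = (q' - P' $ i) + ((q - q') - (P - P') $ i)" by simp
    also have "norm \<dots> \<le> norm (q' - P' $ i) + (norm (q - q') + norm ((P - P') $ i))"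
      by (smt (verit) norm_triangle_ineq norm_triangle_ineq4)
    finally show ?thesis using i Finite_Cartesian_Product.norm_nth_le[of "P - P'" i] by linarith
  qed
  from this[of P q P' q'] this[of P' q' P q] show ?thesis
    by (simp add: norm_minus_commute abs_le_iff)
qed

lemma tendsto_near:
  assumes "(X \<longlongrightarrow> P) F" "(w \<longlongrightarrow> q) F"
  shows "((\<lambda>k. near (X k) (w k)) \<longlongrightarrow> near P q) F"
proof -
  have "((\<lambda>k. norm (w k - q) + norm (X k - P)) \<longlongrightarrow> norm (q - q) + norm (P - P)) F"
    by (intro tendsto_intros assms)
  then have "((\<lambda>k. norm (w k - q) + norm (X k - P)) \<longlongrightarrow> 0) F" by simp
  moreover have "\<forall>\<^sub>F k in F. norm (near (X k) (w k) - near P q) \<le> norm (w k - q) + norm (X k - P)"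
    using near_lipschitz by (intro always_eventually) auto
  ultimately have "((\<lambda>k. near (X k) (w k) - near P q) \<longlongrightarrow> 0) F"
    by (rule Lim_null_comparison[rotated])
  then show ?thesis by (simp add: LIM_zero_cancel)
qed

lemma continuous_on_near: "continuous_on A (near P)"
  by (auto simp: continuous_on_def intro!: tendsto_near tendsto_ident_at)

lemma peak_exists:
  assumes "compact Q" "Q \<noteq> {}"
  obtains v where "peak Q P v"
  using continuous_attains_sup[OF assms continuous_on_near] by (auto simp: peak_def)

lemma H_DC_peak: "peak Q P v \<Longrightarrow> H_DC Q P = near P v"
  unfolding H_DC_def near_def[symmetric] peak_def by (intro cSup_eq_maximum) auto

lemma near_le_H_DC:
  assumes "compact Q" "q \<in> Q"
  shows "near P q \<le> H_DC Q P"
  using peak_exists[of Q P] assms by (metis H_DC_peak emptyE peak_def)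

lemma peak_limit:
  assumes "compact Q" "X \<longlonglongrightarrow> P" "w \<longlonglongrightarrow> v" "\<And>k. peak Q (X k) (w k)"
  shows "peak Q P v"
  unfolding peak_def
proof safe
  show "v \<in> Q" using assms compact_imp_closed closed_sequentially unfolding peak_def by metis
  show "near P q \<le> near P v" if "q \<in> Q" for q
  proof (rule LIMSEQ_le)
    show "(\<lambda>k. near (X k) q) \<longlonglongrightarrow> near P q" by (intro tendsto_near assms tendsto_const)
    show "(\<lambda>k. near (X k) (w k)) \<longlonglongrightarrow> near P v" by (intro tendsto_near assms)
    show "\<exists>N. \<forall>n\<ge>N. near (X n) q \<le> near (X n) (w n)" using assms(4) that unfolding peak_def by blast
  qed
qed

section \<open>First-order analysis at a maximizer in a polygon cut out by half-planes\<close>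

locale halfspace_polygon =
  fixes Q :: "(real^2) set" and F :: "'e set" and nrm :: "'e \<Rightarrow> real^2" and off :: "'e \<Rightarrow> real"
  assumes compact: "compact Q" and nonempty: "Q \<noteq> {}" and finite_F: "finite F"
    and halfspaces: "Q = {x. \<forall>e\<in>F. nrm e \<bullet> x \<le> off e}"
begin

definition tight :: "real^2 \<Rightarrow> 'e set" where
  "tight v = {e\<in>F. nrm e \<bullet> v = off e}"

text \<open>With the edges of the polygon as index set, the cardinality of this set at a point of
  \<open>Q\<close> is the total count of edges and generators in the nondegeneracy
  condition.\<close>

definition elements :: "(real^2)^'n::finite \<Rightarrow> real^2 \<Rightarrow> ('n + 'e) set" where
  "elements P v = nearest P v <+> tight v"

text \<open>A positive inner product with \<open>u\<close> means that moving \<open>v\<close> along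
  \<open>u\<close> approaches the generator or violates the tight constraint, to first
  order.\<close>

definition direction :: "(real^2)^'n::finite \<Rightarrow> real^2 \<Rightarrow> 'n + 'e \<Rightarrow> real^2" where
  "direction P v = case_sum (\<lambda>i. P $ i - v) nrm"

text \<open>
  The set \<open>K\<close> is separate from \<open>P\<close> and \<open>v\<close> because the expression is continuous in \<open>(P, v)\<close> only
  for fixed \<open>K\<close>.
\<close>

definition element_grad :: "('n + 'e) set \<Rightarrow> (real^2)^'n::finite \<Rightarrow> real^2 \<Rightarrow> (real^2)^'n" where
  "element_grad K P v = (\<chi> i. if Inl i \<in> K
     then (weight (direction P v) K (Inl i) /
       ((\<Sum>j | Inl j \<in> K. weight (direction P v) K (Inl j)) * near P v)) *\<^sub>R (P $ i - v) else 0)"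

abbreviation grad :: "(real^2)^'n::finite \<Rightarrow> real^2 \<Rightarrow> (real^2)^'n" where
  "grad P v \<equiv> element_grad (elements P v) P v"

lemma finite_tight: "finite (tight v)"
  using finite_F by (simp add: tight_def)

lemma finite_elements: "finite (elements P v)"
  by (simp add: elements_def finite_tight)

lemma elements_iff: "Inl i \<in> elements P v \<longleftrightarrow> i \<in> nearest P v" "Inr e \<in> elements P v \<longleftrightarrow> e \<in> tight v"
  by (auto simp: elements_def)

lemma peak_positively_spanning:
  assumes "peak Q P v"
  shows "positively_spanning (direction P v) (elements P v)"
  unfolding positively_spanning_def
proof (intro allI impI, rule ccontr)
  fix u assume "u \<noteq> 0" and "\<not> (\<exists>k\<in>elements P v. 0 < direction P v k \<bullet> u)"
  then have "direction P v k \<bullet> u \<le> 0" if "k \<in> elements P v" for k using that by force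
  note nonpos = this
  have uI: "(P $ i - v) \<bullet> u \<le> 0" if "i \<in> nearest P v" for i
    using nonpos[of "Inl i"] that by (simp add: direction_def elements_iff)
  have uE: "nrm e \<bullet> u \<le> 0" if "e \<in> tight v" for e
    using nonpos[of "Inr e"] that by (simp add: direction_def elements_iff)
  have lim: "((\<lambda>t. v + t *\<^sub>R u) \<longlongrightarrow> v + 0 *\<^sub>R u) (at_right 0)"
    by (intro tendsto_intros)
  have vQ: "nrm e \<bullet> v \<le> off e" if "e \<in> F" for e using assms halfspaces that by (auto simp: peak_def)
  have "\<forall>\<^sub>F t in at_right 0. nrm e \<bullet> (v + t *\<^sub>R u) \<le> off e" if "e \<in> F" for e
  proof (cases "e \<in> tight v")
    case True
    then have "nrm e \<bullet> (v + t *\<^sub>R u) \<le> off e" if "t > 0" for t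
      using that uE by (simp add: tight_def inner_add_right mult_nonneg_nonpos)
    then show ?thesis by (intro eventually_at_rightI[of 0 1]) auto
  next
    case False
    then have "nrm e \<bullet> v < off e" using vQ that by (force simp: tight_def)
    moreover have "((\<lambda>t. nrm e \<bullet> (v + t *\<^sub>R u)) \<longlongrightarrow> nrm e \<bullet> (v + 0 *\<^sub>R u)) (at_right 0)"
      by (intro tendsto_intros)
    ultimately show ?thesis by (auto dest!: order_tendstoD(2) elim: eventually_mono)
  qed
  then have "\<forall>\<^sub>F t in at_right 0. \<forall>e\<in>F. nrm e \<bullet> (v + t *\<^sub>R u) \<le> off e"
    using finite_F by (simp add: eventually_ball_finite)
  moreover have "\<forall>\<^sub>F t in at_right 0. near P v < norm (v + t *\<^sub>R u - P $ i)" for i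
  proof (cases "i \<in> nearest P v")
    case True
    have "near P v < norm (v + t *\<^sub>R u - P $ i)" if "t > 0" for t
    proof -
      \<comment> \<open>If \<open>u\<close> is orthogonal to \<open>P $ i - v\<close>, the strict
        increase comes from the quadratic term alone.\<close>
      have "(norm (v + t *\<^sub>R u - P $ i))\<^sup>2 
          = (norm (v - P $ i))\<^sup>2 - 2 * t * ((P $ i - v) \<bullet> u) + t\<^sup>2 * (norm u)\<^sup>2"
        unfolding power2_norm_eq_inner 
        by (simp add: inner_simps inner_commute algebra_simps power2_eq_square)
      moreover have "t * ((P $ i - v) \<bullet> u) \<le> 0" using that uI[OF True] by (simp add: mult_nonneg_nonpos)
      moreover have "t\<^sup>2 * (norm u)\<^sup>2 > 0" using that \<open>u \<noteq> 0\<close> by simp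
      ultimately have "(norm (v - P $ i))\<^sup>2 < (norm (v + t *\<^sub>R u - P $ i))\<^sup>2" by linarith
      then show ?thesis using True by (simp add: nearest_def power_less_imp_less_base)
    qed
    then show ?thesis by (intro eventually_at_rightI[of 0 1]) auto
  next
    case False
    then have "near P v < norm (v - P $ i)" using near_le[of P v i] by (simp add: nearest_def)
    moreover have "((\<lambda>t. norm (v + t *\<^sub>R u - P $ i)) \<longlongrightarrow> norm (v + 0 *\<^sub>R u - P $ i)) (at_right 0)"
      by (intro tendsto_intros)
    ultimately show ?thesis by (auto dest!: order_tendstoD(1))
  qed
  then have "\<forall>\<^sub>F t in at_right 0. near P v < near P (v + t *\<^sub>R u)"
    unfolding near_gt_iff by (simp add: eventually_all_finite)
  ultimately have "\<forall>\<^sub>F t in at_right (0::real). False"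
  proof eventually_elim
    case (elim t)
    then have "v + t *\<^sub>R u \<in> Q" using halfspaces by auto
    with assms elim(2) show False by (auto simp: peak_def not_less)
  qed
  then show False by simp
qed

lemma peak_lower_bound:
  fixes P :: "(real^2)^'n::finite"
  assumes peak: "peak Q P v" and card: "card (elements P v) \<le> 3" and pos: "near P v > 0"
  shows "\<forall>\<^sub>F P' in nhds P. H_DC Q P + grad P v \<bullet> (P' - P) \<le> H_DC Q P'"
proof -
  define a where "a = direction P v"
  define K where "K = elements P v"
  define R where "R = near P v"
  define W where "W = (\<Sum>j\<in>nearest P v. weight a K (Inl j))"
  define g where "g = grad P v"
  have span: "positively_spanning a K" and fin: "finite K" and card': "card K \<le> 3"
    using peak_positively_spanning[OF peak] card finite_elements by (auto simp: a_def K_def)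
  have "R > 0" using pos by (simp add: R_def)
  have w: "weight a K k > 0" if "k \<in> K" for k
    using positively_spanning_weight(2)[OF span fin card' that] .
  have "W > 0" unfolding W_def
    by (intro sum_pos nearest_nonempty w) (auto simp: K_def elements_iff)
  \<comment> \<open>Thus \<open>g\<close> is a convex combination of the gradients at
    \<open>P\<close> of the distances from the fixed point \<open>v\<close> to its nearest
    generators.\<close>
  have g: "g $ i = (if i \<in> nearest P v then (weight a K (Inl i) / (W * R)) *\<^sub>R (P $ i - v) else 0)" for i
    unfolding g_def element_grad_def W_def a_def K_def R_def by (simp add: elements_iff)
  obtain c where c: "c > 0" "\<And>u. u \<noteq> 0 \<Longrightarrow> \<exists>k\<in>K. c * norm u \<le> a k \<bullet> u"
    using positively_spanning_coercive[OF span fin] by blast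
  \<comment> \<open>This bounds the response \<open>u\<close> of \<open>v\<close> to a displacement
    \<open>d\<close>: the prescribed inner products are at most
    \<open>R * (1 + norm g) * norm d\<close>, and coercivity costs the factor
    \<open>1 / c\<close>.\<close>
  define C where "C = R * (1 + norm g) / c"
  have "C \<ge> 0" using c \<open>R > 0\<close> by (simp add: C_def)
  have move: "\<exists>u. norm u \<le> C * norm d \<and> (\<forall>e\<in>tight v. nrm e \<bullet> u = 0) \<and>
      (\<forall>i\<in>nearest P v. (P $ i - v) \<bullet> (u - d $ i) = - R * (g \<bullet> d))" for d
  proof -
    \<comment> \<open>The prescribed inner products keep \<open>v\<close> on its edges and give all
      nearest distances the same first-order change \<open>g \<bullet> d\<close>.\<close>
    define \<beta> where "\<beta> = case_sum (\<lambda>i. (P $ i - v) \<bullet> d $ i - R * (g \<bullet> d)) (\<lambda>_ :: 'e. 0)"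
    have "g \<bullet> d = (\<Sum>i\<in>UNIV. if i \<in> nearest P v then weight a K (Inl i) / (W * R) * ((P $ i - v) \<bullet> d $ i) else 0)"
      unfolding inner_vec_def[of g d] by (intro sum.cong) (auto simp: g)
    also have "\<dots> = (\<Sum>i\<in>nearest P v. weight a K (Inl i) / (W * R) * ((P $ i - v) \<bullet> d $ i))"
      by (simp add: sum.If_cases)
    also have "\<dots> = (\<Sum>i\<in>nearest P v. weight a K (Inl i) * ((P $ i - v) \<bullet> d $ i)) / (W * R)"
      by (simp add: sum_divide_distrib)
    finally have gd: "W * (R * (g \<bullet> d)) = (\<Sum>i\<in>nearest P v. weight a K (Inl i) * ((P $ i - v) \<bullet> d $ i))"
      using \<open>W > 0\<close> \<open>R > 0\<close> by (simp add: field_simps)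
    \<comment> \<open>The solvability condition holds because \<open>g\<close> is built from the
      same weights.\<close>
    have "(\<Sum>k\<in>K. weight a K k * \<beta> k) = (\<Sum>i\<in>nearest P v. weight a K (Inl i) * \<beta> (Inl i))
        + (\<Sum>e\<in>tight v. weight a K (Inr e) * \<beta> (Inr e))"
      using finite_tight unfolding K_def elements_def by (subst sum.Plus) auto
    also have "\<dots> = 0" using gd
      by (simp add: \<beta>_def W_def right_diff_distrib sum_subtractf sum_distrib_right)
    finally obtain u where u: "\<And>k. k \<in> K \<Longrightarrow> a k \<bullet> u = \<beta> k"
      using positively_spanning_weight(3)[OF span fin card'] by blast
    have \<beta>: "\<beta> k \<le> R * (1 + norm g) * norm d" if k: "k \<in> K" for k
    proof (cases k)
      case (Inl i)
      with k have "norm (P $ i - v) = R"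
        by (simp add: K_def elements_iff nearest_def R_def norm_minus_commute)
      then have "(P $ i - v) \<bullet> d $ i \<le> R * norm d"
        using norm_cauchy_schwarz[of "P $ i - v" "d $ i"] Finite_Cartesian_Product.norm_nth_le[of d i] \<open>R > 0\<close>
        by (smt (verit) mult_left_mono)
      moreover have "- (R * (g \<bullet> d)) \<le> R * (norm g * norm d)"
        using Cauchy_Schwarz_ineq2[of g d] \<open>R > 0\<close> by (smt (verit) mult_left_mono mult_minus_right)
      ultimately show ?thesis using Inl by (simp add: \<beta>_def algebra_simps)
    qed (use \<open>R > 0\<close> in \<open>simp add: \<beta>_def\<close>)
    have "c * norm u \<le> R * (1 + norm g) * norm d"
    proof (cases "u = 0")
      case False
      then show ?thesis using c(2)[of u] \<beta> u by force
    qed (use \<open>R > 0\<close> in simp)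
    then have "norm u \<le> C * norm d" using c by (simp add: C_def field_simps)
    moreover have "\<forall>e\<in>tight v. nrm e \<bullet> u = 0"
      using u[of "Inr _"] by (simp add: K_def elements_iff a_def direction_def \<beta>_def)
    moreover have "\<forall>i\<in>nearest P v. (P $ i - v) \<bullet> (u - d $ i) = - R * (g \<bullet> d)"
      using u[of "Inl _"] by (simp add: K_def elements_iff a_def direction_def \<beta>_def inner_diff_right)
    ultimately show ?thesis by blast
  qed
  have "((\<lambda>P'. norm (P' - P)) \<longlongrightarrow> norm (P - P)) (nhds P)"
    by (intro tendsto_intros filterlim_ident)
  then have lim: "((\<lambda>P'. norm (P' - P)) \<longlongrightarrow> 0) (nhds P)" by simp
  have small: "\<forall>\<^sub>F P' in nhds P. b * norm (P' - P) < s" if "s > 0" for b s :: real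
    using order_tendstoD(2)[OF tendsto_mult_left[OF lim, of b], of s] that by simp
  have "\<forall>\<^sub>F P' in nhds P. e \<notin> tight v \<longrightarrow> (norm (nrm e) * C) * norm (P' - P) < off e - nrm e \<bullet> v"
    if "e \<in> F" for e
  proof (cases "e \<in> tight v")
    case False
    then have "nrm e \<bullet> v < off e" using peak halfspaces that by (force simp: tight_def peak_def)
    then show ?thesis by (intro eventually_mono[OF small]) auto
  qed simp
  then have "\<forall>\<^sub>F P' in nhds P. \<forall>e\<in>F. e \<notin> tight v \<longrightarrow>
      (norm (nrm e) * C) * norm (P' - P) < off e - nrm e \<bullet> v"
    using finite_F by (simp add: eventually_ball_finite)
  \<comment> \<open>A farther generator comes closer by at most
    \<open>(C + 1) * norm (P' - P)\<close>, while the target value rises by at most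
    \<open>norm g * norm (P' - P)\<close>.\<close>
  moreover have "\<forall>\<^sub>F P' in nhds P. i \<notin> nearest P v \<longrightarrow>
      (C + 1 + norm g) * norm (P' - P) < norm (v - P $ i) - R" for i
  proof (cases "i \<in> nearest P v")
    case False
    then have "R < norm (v - P $ i)" using near_le[of P v i] by (simp add: nearest_def R_def)
    then show ?thesis by (intro eventually_mono[OF small]) auto
  qed simp
  then have "\<forall>\<^sub>F P' in nhds P. \<forall>i. i \<notin> nearest P v \<longrightarrow>
      (C + 1 + norm g) * norm (P' - P) < norm (v - P $ i) - R"
    by (simp add: eventually_all_finite)
  ultimately show ?thesis
  proof eventually_elim
    case (elim P')
    define d where "d = P' - P"
    have d: "P' $ i = P $ i + d $ i" for i by (simp add: d_def)
    obtain u where u: "norm u \<le> C * norm d" "\<And>e. e \<in> tight v \<Longrightarrow> nrm e \<bullet> u = 0"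
      "\<And>i. i \<in> nearest P v \<Longrightarrow> (P $ i - v) \<bullet> (u - d $ i) = - R * (g \<bullet> d)"
      using move by metis
    have "nrm e \<bullet> (v + u) \<le> off e" if "e \<in> F" for e
    proof (cases "e \<in> tight v")
      case True
      with u(2) show ?thesis by (simp add: tight_def inner_add_right)
    next
      case False
      have "nrm e \<bullet> u \<le> norm (nrm e) * (C * norm d)"
        using norm_cauchy_schwarz[of "nrm e" u] u(1) by (smt (verit) mult_left_mono norm_ge_zero)
      with False elim(1) that show ?thesis by (force simp: d_def inner_add_right mult.assoc)
    qed
    then have vu: "v + u \<in> Q" using halfspaces by auto
    have "R + g \<bullet> d \<le> norm (v + u - P' $ i)" for i
    proof (cases "i \<in> nearest P v")
      case True
      then have n: "norm (v - P $ i) = R" by (simp add: nearest_def R_def)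
      \<comment> \<open>Projecting onto the old direction \<open>v - P $ i\<close> bounds the new
        distance from below by its linearization.\<close>
      have "(v - P $ i) \<bullet> (v + u - P' $ i) = (v - P $ i) \<bullet> (v - P $ i) - (P $ i - v) \<bullet> (u - d $ i)"
        by (simp add: d algebra_simps inner_simps)
      also have "\<dots> = R * (R + g \<bullet> d)"
        using n u(3)[OF True] by (simp add: dot_square_norm power2_eq_square algebra_simps)
      finally have "R * (R + g \<bullet> d) \<le> R * norm (v + u - P' $ i)"
        using norm_cauchy_schwarz[of "v - P $ i" "v + u - P' $ i"] n by simp
      then show ?thesis using \<open>R > 0\<close> by simp
    next
      case False
      have "norm (v - P $ i) = norm ((v + u - P' $ i) - (u - d $ i))" by (simp add: d)
      then have "norm (v - P $ i) \<le> norm (v + u - P' $ i) + (norm u + norm (d $ i))"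
        using norm_triangle_ineq4[of "v + u - P' $ i" "u - d $ i"] norm_triangle_ineq4[of u "d $ i"]
        by linarith
      moreover have "norm (d $ i) \<le> norm d" by (rule Finite_Cartesian_Product.norm_nth_le)
      moreover have "g \<bullet> d \<le> norm g * norm d" by (rule norm_cauchy_schwarz)
      moreover have "C * norm d + norm d + norm g * norm d < norm (v - P $ i) - R"
        using elim(2) False by (simp add: d_def algebra_simps)
      ultimately show ?thesis using u(1) by linarith
    qed
    then have "R + g \<bullet> d \<le> near P' (v + u)" by (simp add: near_ge_iff)
    also have "\<dots> \<le> H_DC Q P'" by (rule near_le_H_DC[OF compact vu])
    finally show ?case by (simp add: H_DC_peak[OF peak] R_def g_def d_def)
  qed
qed

end

subsection \<open>The generalized gradient\<close>

text \<open>Subtracting the linear function of slope \<open>h\<close> leaves a local minimum at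
  \<open>x\<close>, where the derivative vanishes.\<close>

lemma gradient_eq_supporting_slope:
  assumes "GDERIV f x :> g" "\<forall>\<^sub>F y in nhds x. f x + h \<bullet> (y - x) \<le> f y"
  shows "g = h"
proof -
  have "((\<lambda>y. f y - h \<bullet> y) has_derivative (\<lambda>d. d \<bullet> g - h \<bullet> d)) (at x)"
    using assms(1) unfolding gderiv_def by (auto intro!: derivative_eq_intros)
  moreover have "\<forall>\<^sub>F y in nhds x. f x - h \<bullet> x \<le> f y - h \<bullet> y"
    using assms(2) by eventually_elim (simp add: inner_diff_right)
  then have "\<forall>\<^sub>F y in at x. f x - h \<bullet> x \<le> f y - h \<bullet> y"
    unfolding eventually_at_filter by (rule eventually_mono) auto
  ultimately have "(\<lambda>d. d \<bullet> g - h \<bullet> d) = (\<lambda>d. 0)"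
    by (rule has_derivative_local_min)
  then have "(g - h) \<bullet> g - h \<bullet> (g - h) = 0" by (rule fun_cong)
  then have "(g - h) \<bullet> (g - h) = 0" by (simp add: inner_simps inner_commute)
  then show ?thesis by simp
qed

text \<open>Otherwise \<open>G\<close>, and with it the hull, lies in a closed half-space with
  \<open>0\<close> on its boundary.\<close>

lemma interior_convex_hull_ascent:
  assumes "0 \<in> interior (convex hull G)" "d \<noteq> (0::'a::euclidean_space)"
  obtains g where "g \<in> G" "g \<bullet> d > 0"
proof (rule ccontr)
  assume "\<not> thesis"
  with that have "G \<subseteq> {x. x \<bullet> d \<le> 0}" by (force simp: not_less)
  moreover have "convex {x. x \<bullet> d \<le> 0}"
    using convex_halfspace_le[of d 0] by (simp add: inner_commute)
  ultimately have sub: "convex hull G \<subseteq> {x. x \<bullet> d \<le> 0}" by (rule hull_minimal)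
  obtain e where "e > 0" and e: "cball 0 e \<subseteq> convex hull G"
    using assms(1) by (auto simp: mem_interior_cball)
  have "(e / norm d) *\<^sub>R d \<in> cball 0 e" using \<open>e > 0\<close> assms(2) by simp
  then have "(e / norm d) *\<^sub>R d \<in> {x. x \<bullet> d \<le> 0}" using e sub by (meson subsetD)
  then have "(e / norm d) * (d \<bullet> d) \<le> 0" by simp
  moreover have "(e / norm d) * (d \<bullet> d) > 0" using \<open>e > 0\<close> assms(2) by simp
  ultimately show False by simp
qed

text \<open>The neighbourhood of each lower bound depends on \<open>g\<close>, and \<open>G\<close>
  may be infinite. Compactness of the unit sphere leaves finitely many slopes, one of which
  increases along any given direction.\<close>

lemma strict_local_min_of_supporting_slopes:
  fixes f :: "'a::euclidean_space \<Rightarrow> real"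
  assumes G: "\<And>g. g \<in> G \<Longrightarrow> \<forall>\<^sub>F y in nhds x. f x + g \<bullet> (y - x) \<le> f y"
    and "0 \<in> interior (convex hull G)"
  shows "strict_local_min f x"
proof -
  have "open {d. g \<bullet> d > 0}" for g :: 'a by (rule open_halfspace_gt)
  moreover have "sphere 0 1 \<subseteq> (\<Union>g\<in>G. {d. g \<bullet> d > 0})"
  proof
    fix d :: 'a assume "d \<in> sphere 0 1"
    then have "d \<noteq> 0" by auto
    then show "d \<in> (\<Union>g\<in>G. {d. g \<bullet> d > 0})"
      using interior_convex_hull_ascent[OF assms(2)] by blast
  qed
  ultimately obtain D where D: "D \<subseteq> G" "finite D" "sphere 0 1 \<subseteq> (\<Union>g\<in>D. {d. g \<bullet> d > 0})"
    using compactE_image[OF compact_sphere, of G "\<lambda>g. {d. g \<bullet> d > 0}" 0 1] by metis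
  have "\<forall>\<^sub>F y in nhds x. \<forall>g\<in>D. f x + g \<bullet> (y - x) \<le> f y"
    using D G by (intro eventually_ball_finite) auto
  then obtain \<epsilon> where \<epsilon>: "\<epsilon> > 0" "\<And>y. dist y x < \<epsilon> \<Longrightarrow> \<forall>g\<in>D. f x + g \<bullet> (y - x) \<le> f y"
    by (auto simp: eventually_nhds_metric)
  have "f x < f y" if "y \<noteq> x" "dist y x < \<epsilon>" for y
  proof -
    have "(y - x) /\<^sub>R norm (y - x) \<in> sphere 0 1" using that by simp
    then obtain g where g: "g \<in> D" "g \<bullet> ((y - x) /\<^sub>R norm (y - x)) > 0" using D by blast
    then have "g \<bullet> (y - x) > 0" using that by (simp add: zero_less_mult_iff)
    with \<epsilon>(2)[OF that(2)] g(1) show ?thesis by force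
  qed
  with \<epsilon>(1) show ?thesis by (auto simp: strict_local_min_def)
qed

section \<open>Gradients at nearby configurations and their limits\<close>

context halfspace_polygon
begin

text \<open>An equation that fails at the limit also fails nearby, so elements can only be gained in
  the limit.\<close>

lemma eventually_elements_subset:
  assumes X: "X \<longlonglongrightarrow> P" and w: "w \<longlonglongrightarrow> v"
  shows "\<forall>\<^sub>F k in sequentially. elements (X k) (w k) \<subseteq> elements P v"
proof -
  have "\<forall>\<^sub>F k in sequentially. i \<in> nearest (X k) (w k) \<longrightarrow> i \<in> nearest P v" for i
  proof (cases "i \<in> nearest P v")
    case False
    have "(\<lambda>k. norm (w k - X k $ i) - near (X k) (w k)) \<longlonglongrightarrow> norm (v - P $ i) - near P v"
      by (intro tendsto_intros tendsto_near assms)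
    then have "\<forall>\<^sub>F k in sequentially. norm (w k - X k $ i) - near (X k) (w k) \<noteq> 0"
      by (rule tendsto_imp_eventually_ne) (use False in \<open>simp add: nearest_def\<close>)
    then show ?thesis by eventually_elim (simp add: nearest_def)
  qed simp
  then have "\<forall>\<^sub>F k in sequentially. \<forall>i. i \<in> nearest (X k) (w k) \<longrightarrow> i \<in> nearest P v"
    by (simp add: eventually_all_finite)
  moreover have "\<forall>\<^sub>F k in sequentially. e \<in> tight (w k) \<longrightarrow> e \<in> tight v" if "e \<in> F" for e
  proof (cases "e \<in> tight v")
    case False
    have "(\<lambda>k. nrm e \<bullet> w k - off e) \<longlonglongrightarrow> nrm e \<bullet> v - off e"
      by (intro tendsto_intros assms)
    then have "\<forall>\<^sub>F k in sequentially. nrm e \<bullet> w k - off e \<noteq> 0"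
      by (rule tendsto_imp_eventually_ne) (use False that in \<open>simp add: tight_def\<close>)
    then show ?thesis by eventually_elim (simp add: tight_def)
  qed simp
  then have "\<forall>\<^sub>F k in sequentially. \<forall>e\<in>F. e \<in> tight (w k) \<longrightarrow> e \<in> tight v"
    using finite_F by (simp add: eventually_ball_finite)
  ultimately show ?thesis
    by eventually_elim (auto simp: elements_def tight_def)
qed

text \<open>Every peak has at least three elements, so an inclusion into a set of three is an
  equality.\<close>

lemma eventually_elements_eq:
  assumes "X \<longlonglongrightarrow> P" "w \<longlonglongrightarrow> v" "\<And>k. peak Q (X k) (w k)" "card (elements P v) = 3"
  shows "\<forall>\<^sub>F k in sequentially. elements (X k) (w k) = elements P v"
  using eventually_elements_subset[OF assms(1,2)]
proof eventually_elim
  case (elim k)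
  then have "card (elements (X k) (w k)) \<le> 3"
    using assms(4) card_mono[OF finite_elements elim] by simp
  then have "card (elements (X k) (w k)) = 3"
    by (rule positively_spanning_weight(1)[OF peak_positively_spanning[OF assms(3)] finite_elements])
  then show ?case using card_subset_eq[OF finite_elements elim] assms(4) by simp
qed

text \<open>Positive spanning makes the weights, and hence the limits of the denominators,
  positive.\<close>

lemma tendsto_element_grad:
  assumes X: "X \<longlonglongrightarrow> P" and w: "w \<longlonglongrightarrow> v" and pos: "near P v > 0"
    and span: "positively_spanning (direction P v) (elements P v)" and card: "card (elements P v) \<le> 3"
  shows "(\<lambda>k. element_grad (elements P v) (X k) (w k)) \<longlonglongrightarrow> grad P v"
proof -
  define K where "K = elements P v"
  have dir: "(\<lambda>k. direction (X k) (w k) j) \<longlonglongrightarrow> direction P v j" for j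
    unfolding direction_def by (cases j) (auto intro!: tendsto_intros X w)
  have weight: "(\<lambda>k. weight (direction (X k) (w k)) K j) \<longlonglongrightarrow> weight (direction P v) K j" for j
    unfolding weight_def cross2_def by (intro tendsto_intros dir)
  have "{j. Inl j \<in> K} = nearest P v" by (simp add: K_def elements_iff)
  then have "(\<Sum>j | Inl j \<in> K. weight (direction P v) K (Inl j)) > 0"
    using nearest_nonempty positively_spanning_weight(2)[OF span finite_elements card]
    by (intro sum_pos) (auto simp: K_def)
  then show ?thesis
    unfolding element_grad_def K_def[symmetric]
    using pos by (intro vec_tendstoI) (auto intro!: tendsto_intros weight tendsto_near X w)
qed

text \<open>Maximizers along the sequence subconverge to a maximizer \<open>v\<close> at
  \<open>P\<close> and eventually share its elements. The lower bound from this single maximizer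
  already determines the derivative wherever one exists, so the gradients converge to
  \<open>grad P v\<close>.\<close>

lemma clarke_gradient_subset:
  assumes nondeg: "\<And>v. peak Q P v \<Longrightarrow> card (elements P v) \<le> 3"
    and pos: "\<And>v. peak Q P v \<Longrightarrow> near P v > 0"
  shows "clarke_gradient S (H_DC Q) P \<subseteq> convex hull {grad P v | v. peak Q P v}"
  unfolding clarke_gradient_def
proof (rule hull_mono, safe)
  fix l X g
  assume X: "X \<longlonglongrightarrow> P" and der: "\<forall>k. X k \<notin> S \<and> GDERIV (H_DC Q) (X k) :> g k" and g: "g \<longlonglongrightarrow> l"
  have "\<exists>v. peak Q (X k) v" for k using peak_exists[OF compact nonempty] by blast
  then obtain w where w: "\<And>k. peak Q (X k) (w k)" by metis
  then have "\<forall>k. w k \<in> Q" by (simp add: peak_def)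
  then obtain v r where r: "strict_mono r" and v: "(w \<circ> r) \<longlonglongrightarrow> v"
    using compact compact_def by metis
  have X': "(X \<circ> r) \<longlonglongrightarrow> P" and g': "(g \<circ> r) \<longlonglongrightarrow> l"
    using X g r by (simp_all add: LIMSEQ_subseq_LIMSEQ)
  have w': "peak Q ((X \<circ> r) k) ((w \<circ> r) k)" for k using w by simp
  have peak: "peak Q P v" using peak_limit[OF compact X' v w'] .
  have span: "positively_spanning (direction P v) (elements P v)"
    by (rule peak_positively_spanning[OF peak])
  have card: "card (elements P v) = 3"
    by (rule positively_spanning_weight(1)[OF span finite_elements nondeg[OF peak]])
  have "\<forall>\<^sub>F k in sequentially. 0 < near ((X \<circ> r) k) ((w \<circ> r) k)"
    using order_tendstoD(1)[OF tendsto_near[OF X' v] pos[OF peak]] .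
  then have "\<forall>\<^sub>F k in sequentially.
      (g \<circ> r) k = element_grad (elements P v) ((X \<circ> r) k) ((w \<circ> r) k)"
    using eventually_elements_eq[OF X' v w' card]
  proof eventually_elim
    case (elim k)
    have "(g \<circ> r) k = grad ((X \<circ> r) k) ((w \<circ> r) k)"
      using der peak_lower_bound[OF w', of k] elim card
      by (intro gradient_eq_supporting_slope[of "H_DC Q" "(X \<circ> r) k"]) auto
    then show ?case using elim(2) by simp
  qed
  moreover have "(\<lambda>k. element_grad (elements P v) ((X \<circ> r) k) ((w \<circ> r) k)) \<longlonglongrightarrow> grad P v"
    using tendsto_element_grad[OF X' v pos[OF peak] span] card by simp
  ultimately have "(g \<circ> r) \<longlonglongrightarrow> grad P v" by (simp add: tendsto_cong)
  then have "l = grad P v" using g' LIMSEQ_unique by blast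
  with peak show "\<exists>v. l = grad P v \<and> peak Q P v" by blast
qed

text \<open>Component \<open>i\<close> of the gradient is \<open>0\<close> or a positive multiple of
  \<open>P $ i - v\<close>.\<close>

lemma grad_nth_ascent:
  assumes "peak Q P v" "card (elements P v) \<le> 3" and "grad P v \<bullet> axis i w > 0"
  shows "i \<in> nearest P v" "(P $ i - v) \<bullet> w > 0"
proof -
  let ?c = "weight (direction P v) (elements P v)"
  have w: "?c k > 0" if "k \<in> elements P v" for k
    using positively_spanning_weight(2)[OF peak_positively_spanning[OF assms(1)] finite_elements assms(2) that] .
  have g: "grad P v $ i \<bullet> w > 0" using assms(3) by (simp add: inner_axis)
  then show i: "i \<in> nearest P v"
    by (auto simp: element_grad_def elements_iff split: if_splits)
  have "(\<Sum>j | Inl j \<in> elements P v. ?c (Inl j)) * near P v \<ge> 0"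
    using w by (intro mult_nonneg_nonneg near_nonneg sum_nonneg) (auto intro: less_imp_le)
  moreover have "?c (Inl i) > 0" using w i by (simp add: elements_iff)
  ultimately show "(P $ i - v) \<bullet> w > 0"
    using g i by (auto simp: element_grad_def elements_iff zero_less_mult_iff zero_less_divide_iff)
qed

end

subsection \<open>Voronoi cells\<close>

text \<open>In the plane the edges of \<open>Q\<close> are its facets. A segment from an interior
  point to a point outside meets the frontier on an edge; the inequality of that edge is strict at
  the interior point, so it fails at the outer end.\<close>

lemma convex_polygon_edge_halfspaces:
  assumes "convex_polygon Q"
  obtains nrm off where "finite {e. e edge_of Q}"
    and "\<And>e. e edge_of Q \<Longrightarrow> e = Q \<inter> {x. nrm e \<bullet> x = off e}"
    and "Q = {x. \<forall>e\<in>{e. e edge_of Q}. nrm e \<bullet> x \<le> off e}"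
proof -
  have poly: "polytope Q" and int: "interior Q \<noteq> {}"
    using assms by (auto simp: convex_polygon_def)
  have "aff_dim Q = 2" using aff_dim_nonempty_interior[OF int] by simp
  then have edge_iff: "e edge_of Q \<longleftrightarrow> e facet_of Q" for e
    by (auto simp: edge_of_def facet_of_def)
  have "\<exists>a b. e edge_of Q \<longrightarrow> a \<noteq> 0 \<and> Q \<subseteq> {x. a \<bullet> x \<le> b} \<and> e = Q \<inter> {x. a \<bullet> x = b}" for e
    using facet_of_polyhedron[OF polytope_imp_polyhedron[OF poly]] edge_iff by metis
  then obtain nrm off where h: "\<And>e. e edge_of Q \<Longrightarrow>
      nrm e \<noteq> 0 \<and> Q \<subseteq> {x. nrm e \<bullet> x \<le> off e} \<and> e = Q \<inter> {x. nrm e \<bullet> x = off e}"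
    by metis
  show thesis
  proof
    show "finite {e. e edge_of Q}"
      unfolding edge_iff by (rule finite_polytope_facets[OF poly])
    show "e = Q \<inter> {x. nrm e \<bullet> x = off e}" if "e edge_of Q" for e using h that by blast
    show "Q = {x. \<forall>e\<in>{e. e edge_of Q}. nrm e \<bullet> x \<le> off e}"
    proof (intro subset_antisym subsetI)
      fix x assume x: "x \<in> {x. \<forall>e\<in>{e. e edge_of Q}. nrm e \<bullet> x \<le> off e}"
      show "x \<in> Q"
      proof (rule ccontr)
        assume "x \<notin> Q"
        obtain z where z: "z \<in> interior Q" using int by blast
        have "closed_segment z x \<inter> frontier Q \<noteq> {}"
          using z interior_subset \<open>x \<notin> Q\<close> by (intro connected_Int_frontier) auto
        then obtain w where w: "w \<in> closed_segment z x" "w \<in> frontier Q" by blast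
        then have "w \<in> Q"
          using polytope_imp_closed[OF poly] frontier_subset_closed by blast
        have "w \<in> rel_frontier Q" using w rel_frontier_nonempty_interior[OF int] by simp
        then obtain e where e: "e edge_of Q" "w \<in> e"
          using rel_frontier_of_polyhedron[OF polytope_imp_polyhedron[OF poly]] edge_iff by auto
        have "interior Q \<subseteq> interior {x. nrm e \<bullet> x \<le> off e}" using h[OF e(1)] by (intro interior_mono) auto
        then have "nrm e \<bullet> z < off e" using z h[OF e(1)] by auto
        moreover have "nrm e \<bullet> w = off e" using h e by blast
        moreover have "nrm e \<bullet> x \<le> off e" using x e by auto
        moreover obtain t where t: "0 \<le> t" "t \<le> 1" "w = (1 - t) *\<^sub>R z + t *\<^sub>R x"
          using w(1) by (auto simp: in_segment)
        moreover have "t \<noteq> 1" using t(3) \<open>w \<in> Q\<close> \<open>x \<notin> Q\<close> by auto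
        ultimately have "(1 - t) * (nrm e \<bullet> z) + t * (nrm e \<bullet> x) < (1 - t) * off e + t * off e"
          by (intro add_less_le_mono mult_strict_left_mono mult_left_mono) auto
        moreover have "nrm e \<bullet> w = (1 - t) * (nrm e \<bullet> z) + t * (nrm e \<bullet> x)"
          by (simp add: t(3) inner_add_right)
        moreover have "(1 - t) * off e + t * off e = off e" by (simp add: algebra_simps)
        ultimately show False using \<open>nrm e \<bullet> w = off e\<close> by simp
      qed
    qed (use h in blast)
  qed
qed

lemma mem_voronoi_cell_iff: "q \<in> voronoi_cell Q P i \<longleftrightarrow> q \<in> Q \<and> i \<in> nearest P q"
proof -
  have "i \<in> nearest P q \<longleftrightarrow> (\<forall>j. norm (q - P $ i) \<le> norm (q - P $ j))"
    using near_le[of P q i] near_le[of P q] near_ge_iff[of "norm (q - P $ i)" P q]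
    by (auto simp: nearest_def intro: antisym)
  then show ?thesis by (auto simp: voronoi_cell_def)
qed

text \<open>A peak is a point of the cell of a nearest generator that is farthest from this
  generator, and such a point is never strictly inside a segment of the cell.\<close>

lemma peak_voronoi_vertex:
  assumes "peak Q P v"
  shows "voronoi_vertex Q P v"
proof -
  obtain i where i: "i \<in> nearest P v" using nearest_nonempty by blast
  have "norm (q - P $ i) \<le> norm (v - P $ i)" if "q \<in> voronoi_cell Q P i" for q
    using assms that i by (auto simp: mem_voronoi_cell_iff peak_def nearest_def)
  then have "dist (P $ i) q \<le> dist (P $ i) v" if "q \<in> voronoi_cell Q P i" for q
    using that by (simp add: dist_norm norm_minus_commute)
  moreover have "v \<in> voronoi_cell Q P i" using assms i by (simp add: mem_voronoi_cell_iff peak_def)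
  ultimately have "v extreme_point_of voronoi_cell Q P i"
    unfolding extreme_point_of_def by (meson dist_decreases_open_segment not_le)
  then show ?thesis by (auto simp: voronoi_vertex_def)
qed

text \<open>On the cell of \<open>i\<close> the distance to \<open>P $ i\<close> equals
  \<open>near P\<close>, so the peak attains both suprema.\<close>

lemma G_cell_eq_H_DC:
  assumes "peak Q P v" "i \<in> nearest P v"
  shows "G_cell Q P i = H_DC Q P"
  unfolding H_DC_peak[OF assms(1)] G_cell_def
proof (rule cSup_eq_maximum)
  show "near P v \<in> (\<lambda>q. norm (q - P $ i)) ` voronoi_cell Q P i"
    using assms by (intro image_eqI[of _ _ v]) (auto simp: mem_voronoi_cell_iff peak_def nearest_def)
  show "x \<le> near P v" if "x \<in> (\<lambda>q. norm (q - P $ i)) ` voronoi_cell Q P i" for x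
    using assms(1) that by (auto simp: mem_voronoi_cell_iff peak_def nearest_def)
qed

text \<open>Shifting the centre by \<open>w\<close> does not reduce, to first order, the distance to
  some point at distance \<open>R\<close>, and the quadratic term makes it larger. Every other
  centre thus needs a larger radius.\<close>

lemma circumcenter_eqI:
  assumes "W \<subseteq> cball p R"
    and "\<And>w. w \<noteq> 0 \<Longrightarrow> \<exists>v\<in>W. norm (v - p) = R \<and> (p - v) \<bullet> w \<ge> 0"
  shows "circumcenter W = p"
proof -
  have far: "R < r" if W: "W \<subseteq> cball c r" and "c \<noteq> p" for c r
  proof -
    obtain v where v: "v \<in> W" "norm (v - p) = R" "(p - v) \<bullet> (c - p) \<ge> 0"
      using assms(2)[of "c - p"] \<open>c \<noteq> p\<close> by auto
    have "(norm (c - v))\<^sup>2 = (norm (v - p))\<^sup>2 + 2 * ((p - v) \<bullet> (c - p)) + (norm (c - p))\<^sup>2"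
      unfolding power2_norm_eq_inner by (simp add: inner_simps inner_commute algebra_simps)
    moreover have "(norm (c - p))\<^sup>2 > 0" using \<open>c \<noteq> p\<close> by simp
    ultimately have "R\<^sup>2 < (norm (c - v))\<^sup>2" using v(3) unfolding v(2) by linarith
    then have "R < norm (c - v)" by (rule power_less_imp_less_base) simp
    also have "\<dots> \<le> r" using W v(1) by (auto simp: dist_norm)
    finally show ?thesis .
  qed
  have "R \<le> r" if W: "W \<subseteq> cball p r" for r
  proof -
    obtain v where "v \<in> W" "norm (v - p) = R"
      \<comment> \<open>Any nonzero direction provides a point at distance \<open>R\<close>.\<close>
      using assms(2)[of "axis 1 1"] by (auto simp: axis_eq_0_iff)
    with W show ?thesis by (auto simp: dist_norm norm_minus_commute)
  qed
  with far have min: "R \<le> r" if "W \<subseteq> cball c r" for c r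
    using that by (metis less_imp_le)
  show ?thesis
    unfolding circumcenter_def
  proof (rule the_equality)
    show "\<exists>r. W \<subseteq> cball p r \<and> (\<forall>c' r'. W \<subseteq> cball c' r' \<longrightarrow> r \<le> r')"
      using assms(1) min by blast
    show "c = p" if "\<exists>r. W \<subseteq> cball c r \<and> (\<forall>c' r'. W \<subseteq> cball c' r' \<longrightarrow> r \<le> r')" for c
      using that far assms(1) by (meson not_le)
  qed
qed

theorem theorem4p7:
  fixes Q :: "(real^2) set"
    and P :: "(real^2)^'n::finite"
    and S :: "((real^2)^'n::finite) set"
  assumes "convex_polygon Q"
    and "\<And>i. P $ i \<in> Q"
    and "nondegenerate_configuration Q P"
    and "negligible S"
    and "0 \<in> interior (clarke_gradient S (H_DC Q) P)"
  shows "strict_local_min (H_DC Q) P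
    \<and> (\<forall>i. active Q P i)
    \<and> (\<forall>i. P $ i = circumcenter (voronoi_cell Q P i))"
proof -
  obtain nrm off where fin: "finite {e. e edge_of Q}"
    and edges: "\<And>e. e edge_of Q \<Longrightarrow> e = Q \<inter> {x. nrm e \<bullet> x = off e}"
    and Q: "Q = {x. \<forall>e\<in>{e. e edge_of Q}. nrm e \<bullet> x \<le> off e}"
    using convex_polygon_edge_halfspaces[OF assms(1)] by blast
  have int: "interior Q \<noteq> {}" and comp: "compact Q"
    using assms(1) polytope_imp_compact by (auto simp: convex_polygon_def)
  then have "Q \<noteq> {}" by auto
  interpret halfspace_polygon Q "{e. e edge_of Q}" nrm off
    by unfold_locales (fact comp \<open>Q \<noteq> {}\<close> fin Q)+
  \<comment> \<open>A peak is a Voronoi vertex, and each of the three admissible cases of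
    nondegeneracy counts three elements.\<close>
  have card: "card (elements P v) = 3" if peak: "peak Q P v" for v
  proof -
    have "v \<in> Q" using peak by (simp add: peak_def)
    then have "determining_edges Q v = tight v"
      using edges by (auto simp: determining_edges_def tight_def)
    moreover have "determining_generators Q P v = nearest P v"
      using \<open>v \<in> Q\<close> by (auto simp: determining_generators_def mem_voronoi_cell_iff)
    moreover have "nondegenerate_vertex Q P v"
      using assms(3) peak_voronoi_vertex[OF peak] by (simp add: nondegenerate_configuration_def)
    ultimately show ?thesis
      using finite_tight[of v] by (auto simp: nondegenerate_vertex_def Let_def elements_def card_Plus)
  qed
  have pos: "near P v > 0" if peak: "peak Q P v" for v
  proof -
    \<comment> \<open>An infinite \<open>Q\<close> has a point that is not a generator, so the
      maximum is positive.\<close>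
    have "infinite Q" using int empty_interior_finite by blast
    then obtain q where "q \<in> Q" "q \<notin> range (($) P)"
      by (meson finite finite_imageI finite_subset subsetI)
    then have "0 < near P q" using near_eq_0_imp near_nonneg[of P q] by (metis less_eq_real_def)
    also have "\<dots> \<le> near P v" using peak \<open>q \<in> Q\<close> by (simp add: peak_def)
    finally show ?thesis .
  qed
  define G where "G = {grad P v | v. peak Q P v}"
  have "clarke_gradient S (H_DC Q) P \<subseteq> convex hull G"
    unfolding G_def by (rule clarke_gradient_subset) (auto simp: card pos)
  then have G: "0 \<in> interior (convex hull G)" using assms(5) interior_mono by blast
  have ascent: "\<exists>v. peak Q P v \<and> i \<in> nearest P v \<and> (P $ i - v) \<bullet> w > 0" if "w \<noteq> 0" for i w
  proof -
    \<comment> \<open>The displacement \<open>axis i w\<close> moves generator \<open>i\<close>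
      alone.\<close>
    have "axis i w \<noteq> 0" using that by (simp add: axis_eq_0_iff)
    then obtain g where "g \<in> G" "g \<bullet> axis i w > 0"
      by (rule interior_convex_hull_ascent[OF G])
    then obtain v where v: "peak Q P v" "grad P v \<bullet> axis i w > 0" by (auto simp: G_def)
    with grad_nth_ascent[OF v(1) _ v(2)] card show ?thesis by auto
  qed
  have "strict_local_min (H_DC Q) P"
    using G by (rule strict_local_min_of_supporting_slopes[rotated])
      (auto simp: G_def card pos intro!: peak_lower_bound)
  moreover have "active Q P i" for i
    using ascent[of "axis 1 1" i] by (auto simp: active_def axis_eq_0_iff G_cell_eq_H_DC)
  moreover have "circumcenter (voronoi_cell Q P i) = P $ i" for i
  proof (rule circumcenter_eqI)
    show "voronoi_cell Q P i \<subseteq> cball (P $ i) (H_DC Q P)"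
      using near_le_H_DC[OF comp, of _ P]
      by (auto simp: mem_voronoi_cell_iff nearest_def dist_norm norm_minus_commute)
    show "\<exists>v\<in>voronoi_cell Q P i. norm (v - P $ i) = H_DC Q P \<and> (P $ i - v) \<bullet> w \<ge> 0" if "w \<noteq> 0" for w
      using ascent[OF that, of i]
      by (auto simp: mem_voronoi_cell_iff nearest_def H_DC_peak peak_def intro!: less_imp_le)
  qed
  ultimately show ?thesis by simp
qed

end
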